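(* Let $m>1$ and $n\in\mathbb N_0$, and write $n=a_0+a_1m+\dots+a_sm^s$ with $0\le a_j\le m-1$ for $j=0,\dots,s$. Then $$b_m(mn)\equiv\prod_{i=0}^{s}(a_i+1)+m\Bigg(\sum_{i=1}^{s}\frac{a_i(a_i+1)}{2}\prod_{\substack{j=0\\ j\ne i,\,i-1}}^{s}(a_j+1)\Bigg)\pmod{\mu_2},$$ where $\mu_2=m^2$ if $m$ is odd and $\mu_2=m^2/2$ if $m$ is even.
   Context: $\mathbb N_0=\{0,1,2,\dots\}$. For $m\ge2$ and $n\in\mathbb N_0$, $b_m(n)$ is the number of $m$-ary partitions of $n$, i.e. the number of representations $n=n_0+n_1m+\dots+n_tm^t$ with all $n_i\in\mathbb N_0$. Empty sums are $0$ and empty products are $1$. *)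

theory Defs
  imports "HOL-Number_Theory.Cong"
begin

text \<open>
  A representation \<open>n = n\<^sub>0 + n\<^sub>1 m + \<dots> + n\<^sub>t m\<^sup>t\<close> is given by its
  multiplicity function \<open>i \<mapsto> n\<^sub>i\<close>, which has finite support; so representations that
  differ only by trailing zero coefficients are identified. For \<open>m \<ge> 2\<close> there are only
  finitely many of them. (For \<open>m \<le> 1\<close> and \<open>n > 0\<close> the set is infinite, and its \<open>card\<close>
  is a meaningless \<open>0\<close>.)
\<close>

definition mary_partitions :: "nat \<Rightarrow> nat \<Rightarrow> (nat \<Rightarrow> nat) set" where
  "mary_partitions m n =
     {c. finite {i. c i \<noteq> 0} \<and> n = (\<Sum>i | c i \<noteq> 0. c i * m ^ i)}"

definition mary_partition_count :: "nat \<Rightarrow> nat \<Rightarrow> nat" where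
  "mary_partition_count m n = card (mary_partitions m n)"

text \<open>The division is exact, as \<open>m\<close> is even in that branch.\<close>

definition mu2 :: "nat \<Rightarrow> nat" where
  "mu2 m = (if odd m then m\<^sup>2 else m\<^sup>2 div 2)"

end

(* Write b = b_m and B(n) = b(m n).  Splitting off the number of parts equal to 1 gives
   b(N) = \<Sum>k\<le>N div m. b(k), hence for r < m
     B(m q + r) = (r + 1) B(q) + m S(q),   where S(q) = \<Sum>k<q. B(k).
   Modulo m this is B(m q + r) \<equiv> (r + 1) B(q), so B(n) is congruent to the product of the a_i + 1.
   Feeding this back into S: modulo m (m odd) or m/2 (m even) a full block of m consecutive
   values of B contributes a multiple of m (m + 1) / 2, i.e. nothing, and
   S(m p + r) \<equiv> r (r + 1) / 2 * B(p).  The resulting recurrence for B modulo mu2 m is the one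
   satisfied by the right-hand side. *)
theory Submission
  imports Defs
begin

section \<open>Recurrences for the number of m-ary partitions\<close>

text \<open>Prepending \<open>x\<close> as the number of parts 1 moves every part counted by
  \<open>c\<close> up one power of m, so the total of \<open>c\<close> is multiplied by m.\<close>

lemma case_nat_in_mary_partitions_iff:
  "case_nat x c \<in> mary_partitions m N \<longleftrightarrow> (\<exists>k. N = x + m * k \<and> c \<in> mary_partitions m k)"
proof -
  let ?S = "{i. c i \<noteq> 0}"
  let ?T = "{i. case_nat x c i \<noteq> 0}"
  have T: "?T = (if x = 0 then {} else {0}) \<union> Suc ` ?S"
  proof (intro set_eqI)
    fix i show "i \<in> ?T \<longleftrightarrow> i \<in> (if x = 0 then {} else {0}) \<union> Suc ` ?S"
      by (cases i) auto
  qed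
  have fin: "finite ?T \<longleftrightarrow> finite ?S"
    unfolding T by (auto simp: finite_image_iff)
  have val: "(\<Sum>i\<in>?T. case_nat x c i * m ^ i) = x + m * (\<Sum>i\<in>?S. c i * m ^ i)"
    if "finite ?S"
  proof -
    have "(\<Sum>i\<in>?T. case_nat x c i * m ^ i) =
        (\<Sum>i\<in>(if x = 0 then {} else {0}). case_nat x c i * m ^ i) +
        (\<Sum>i\<in>Suc ` ?S. case_nat x c i * m ^ i)"
      unfolding T using that by (intro sum.union_disjoint) auto
    also have "\<dots> = x + m * (\<Sum>i\<in>?S. c i * m ^ i)"
      by (simp add: sum.reindex sum_distrib_left mult_ac)
    finally show ?thesis .
  qed
  show ?thesis
    unfolding mary_partitions_def using fin val by auto
qed

text \<open>The tail fixes k, and k forces the number of ones to be N - m k; the bound on k keeps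
  this subtraction from truncating.\<close>

lemma mary_partitions_eq_Union:
  assumes "m > 0"
  shows "mary_partitions m N =
    (\<Union>k\<le>N div m. case_nat (N - m * k) ` mary_partitions m k)"
proof (intro set_eqI iffI)
  fix c assume c: "c \<in> mary_partitions m N"
  have split: "c = case_nat (c 0) (\<lambda>i. c (Suc i))"
    by (auto split: nat.splits)
  with c have "case_nat (c 0) (\<lambda>i. c (Suc i)) \<in> mary_partitions m N"
    by (rule subst[rotated])
  then obtain k where k: "N = c 0 + m * k" "(\<lambda>i. c (Suc i)) \<in> mary_partitions m k"
    unfolding case_nat_in_mary_partitions_iff by blast
  have "k \<le> N div m" "c 0 = N - m * k"
    using k(1) assms by (simp_all add: less_eq_div_iff_mult_less_eq mult.commute)
  then show "c \<in> (\<Union>k\<le>N div m. case_nat (N - m * k) ` mary_partitions m k)"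
    using k(2) by (subst split) auto
next
  fix c assume "c \<in> (\<Union>k\<le>N div m. case_nat (N - m * k) ` mary_partitions m k)"
  then obtain k c' where k: "k \<le> N div m" "c = case_nat (N - m * k) c'"
      "c' \<in> mary_partitions m k"
    by auto
  have "N = (N - m * k) + m * k"
    using k(1) assms by (simp add: less_eq_div_iff_mult_less_eq mult.commute)
  then show "c \<in> mary_partitions m N"
    unfolding k(2) case_nat_in_mary_partitions_iff using k(3) by blast
qed

lemma mary_partitions_0:
  assumes "m > 0"
  shows "mary_partitions m 0 = {\<lambda>_. 0}"
proof -
  have "c = (\<lambda>_. 0)" if "c \<in> mary_partitions m 0" for c
    using that assms by (auto simp: mary_partitions_def fun_eq_iff)
  moreover have "(\<lambda>_. 0) \<in> mary_partitions m 0"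
    by (simp add: mary_partitions_def)
  ultimately show ?thesis
    by blast
qed

lemma finite_mary_partitions:
  assumes "m > 1"
  shows "finite (mary_partitions m N)"
proof (induction N rule: less_induct)
  case (less N)
  show ?case
  \<comment> \<open>At N = 0 the union refers back to \<open>mary_partitions m 0\<close> itself, so
    this case is settled directly.\<close>
  proof (cases "N = 0")
    case True
    then show ?thesis
      using assms by (simp add: mary_partitions_0)
  next
    case False
    then have "N div m < N"
      using assms by simp
    then have "finite (mary_partitions m k)" if "k \<le> N div m" for k
      using that less by simp
    moreover have "mary_partitions m N =
        (\<Union>k\<le>N div m. case_nat (N - m * k) ` mary_partitions m k)"
      using assms by (intro mary_partitions_eq_Union) simp
    ultimately show ?thesis
      by simp
  qed
qed

lemma mary_partition_count_0:
  "m > 0 \<Longrightarrow> mary_partition_count m 0 = 1"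
  by (simp add: mary_partition_count_def mary_partitions_0)

lemma mary_partition_count_eq_sum:
  assumes "m > 1"
  shows "mary_partition_count m N = (\<Sum>k\<le>N div m. mary_partition_count m k)"
proof -
  have inj: "inj_on (case_nat x) A" for x :: nat and A :: "(nat \<Rightarrow> nat) set"
  proof (intro inj_onI ext)
    fix c d :: "nat \<Rightarrow> nat" and i
    assume "case_nat x c = case_nat x d"
    then show "c i = d i"
      by (auto dest: fun_cong[where x = "Suc i"])
  qed
  \<comment> \<open>Distinct k are told apart by the number of ones, read off at index 0.\<close>
  have disj: "case_nat (N - m * k) ` A \<inter> case_nat (N - m * l) ` B = {}"
    if "k \<le> N div m" "l \<le> N div m" "k \<noteq> l" for k l and A B :: "(nat \<Rightarrow> nat) set"
  proof -
    have "m * k \<le> N" "m * l \<le> N" "m * k \<noteq> m * l"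
      using that assms by (simp_all add: less_eq_div_iff_mult_less_eq mult.commute)
    then have "N - m * k \<noteq> N - m * l"
      by linarith
    then show ?thesis
      by (auto dest: fun_cong[where x = 0])
  qed
  have "card (mary_partitions m N) =
      card (\<Union>k\<le>N div m. case_nat (N - m * k) ` mary_partitions m k)"
    using mary_partitions_eq_Union[of m N] assms by simp
  also have "\<dots> = (\<Sum>k\<le>N div m. card (case_nat (N - m * k) ` mary_partitions m k))"
    using disj finite_mary_partitions[OF assms] by (intro card_UN_disjoint) (simp_all del: image_Int)
  also have "\<dots> = (\<Sum>k\<le>N div m. card (mary_partitions m k))"
    by (simp add: card_image inj)
  finally show ?thesis
    by (simp add: mary_partition_count_def)
qed

text \<open>The sum formula sees N only through N div m, so b is constant on each block of m
  arguments starting at a multiple of m.\<close>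

lemma mary_partition_count_eq_mult_div:
  assumes "m > 1"
  shows "mary_partition_count m N = mary_partition_count m (m * (N div m))"
  using mary_partition_count_eq_sum[OF assms, of N]
    mary_partition_count_eq_sum[OF assms, of "m * (N div m)"] assms by simp

lemma sum_lessThan_mult_add:
  fixes f :: "nat \<Rightarrow> 'a :: comm_monoid_add"
  shows "(\<Sum>k<m * q + r. f k) = (\<Sum>p<q. \<Sum>i<m. f (m * p + i)) + (\<Sum>i<r. f (m * q + i))"
proof -
  have add: "(\<Sum>k<u + v. f k) = (\<Sum>k<u. f k) + (\<Sum>i<v. f (u + i))" for u v
    by (induction v) (auto simp: add.assoc)
  have "(\<Sum>k<m * q. f k) = (\<Sum>p<q. \<Sum>i<m. f (m * p + i))"
  proof (induction q)
    case (Suc q)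
    then show ?case
      using add[of "m * q" m] by (simp add: add.commute)
  qed simp
  then show ?thesis
    by (simp add: add)
qed

lemma mary_partition_count_mult_add:
  assumes "m > 1" "r < m"
  shows "mary_partition_count m (m * (m * q + r)) =
    (r + 1) * mary_partition_count m (m * q) + m * (\<Sum>k<q. mary_partition_count m (m * k))"
proof -
  let ?b = "mary_partition_count m"
  have block: "?b (m * p + i) = ?b (m * p)" if "i < m" for p i
    using mary_partition_count_eq_mult_div[OF assms(1), of "m * p + i"] that by simp
  \<comment> \<open>The index m q + r is itself included, so the last block contributes r + 1 terms;
    r < m keeps them all inside that block.\<close>
  have "?b (m * (m * q + r)) = (\<Sum>k<m * q + Suc r. ?b k)"
    using mary_partition_count_eq_sum[OF assms(1), of "m * (m * q + r)"] assms(1)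
    by (simp add: lessThan_Suc_atMost)
  also have "\<dots> = (\<Sum>p<q. \<Sum>i<m. ?b (m * p)) + (\<Sum>i<Suc r. ?b (m * q))"
    unfolding sum_lessThan_mult_add
    using assms(2) by (intro arg_cong2[of _ _ _ _ "(+)"] sum.cong refl block) auto
  finally show ?thesis
    by (simp add: sum_distrib_left)
qed

section \<open>Congruences\<close>

lemma mary_partition_count_mult_add_cong:
  assumes "m > 1" "r < m"
  shows "[mary_partition_count m (m * (m * q + r)) =
    (r + 1) * mary_partition_count m (m * q)] (mod m)"
  by (simp only: mary_partition_count_mult_add[OF assms]) (simp add: cong_def)

text \<open>Each induction step strips the lowest digit, which contributes its factor and shifts the
  others down. The range \<open>j < s\<close> admits the empty digit string, which the theorem needs
  when only two digits are present.\<close>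

lemma mary_partition_count_digits_cong:
  assumes "m > 1" "\<And>j. j < s \<Longrightarrow> a j < m"
  shows "[mary_partition_count m (m * (\<Sum>j<s. a j * m ^ j)) = (\<Prod>j<s. a j + 1)] (mod m)"
  using assms(2)
proof (induction s arbitrary: a)
  case 0
  then show ?case
    using assms(1) by (simp add: mary_partition_count_0)
next
  case (Suc s)
  let ?q = "\<Sum>j<s. a (Suc j) * m ^ j"
  have "(\<Sum>j<Suc s. a j * m ^ j) = m * ?q + a 0"
    by (subst sum.lessThan_Suc_shift) (simp add: sum_distrib_left mult_ac)
  moreover have "[mary_partition_count m (m * (m * ?q + a 0)) =
      (a 0 + 1) * mary_partition_count m (m * ?q)] (mod m)"
    using assms(1) Suc.prems by (intro mary_partition_count_mult_add_cong) auto
  moreover have "[(a 0 + 1) * mary_partition_count m (m * ?q) =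
      (a 0 + 1) * (\<Prod>j<s. a (Suc j) + 1)] (mod m)"
    using Suc.prems by (intro cong_scalar_left Suc.IH) auto
  moreover have "(\<Prod>j<Suc s. a j + 1) = (a 0 + 1) * (\<Prod>j<s. a (Suc j) + 1)"
    by (rule prod.lessThan_Suc_shift)
  ultimately show ?case
    by (simp only:) (blast intro: cong_trans)
qed

lemma sum_Suc_lessThan: "(\<Sum>i<r. i + 1) = r * (r + 1) div (2 :: nat)"
  by (induction r) auto

text \<open>The modulus \<open>mu2 m\<close> divides m^2; hence, behind a factor m, knowledge modulo
  m is enough.\<close>

lemma cong_mult_mu2:
  assumes "[x = y] (mod m)"
  shows "[m * x = m * y] (mod mu2 m)"
proof -
  have "[m * x = m * y] (mod m\<^sup>2)"
    using assms by (simp add: cong_def power2_eq_square flip: mult_mod_right)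
  moreover have "mu2 m dvd m\<^sup>2"
    by (auto simp: mu2_def power2_eq_square elim!: evenE)
  ultimately show ?thesis
    using cong_dvd_modulus_nat by blast
qed

text \<open>Full blocks vanish and only the partial one survives. Keeping the factor m on both sides
  treats both parities of m with the single modulus \<open>mu2 m\<close>.\<close>

lemma sum_mary_partition_count_cong:
  assumes "m > 1" "r < m"
  shows "[m * (\<Sum>k<m * p + r. mary_partition_count m (m * k)) =
    m * (r * (r + 1) div 2 * mary_partition_count m (m * p))] (mod mu2 m)"
proof -
  let ?B = "\<lambda>k. mary_partition_count m (m * k)"
  \<comment> \<open>The triangular number m (m + 1) / 2 is a multiple of m for odd m, but only of m
    / 2 for even m: this is the source of the two cases in \<open>mu2\<close>.\<close>
  have triangle: "mu2 m dvd m * (m * (m + 1) div 2)"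
  proof (cases "odd m")
    case True
    then obtain l where "m + 1 = 2 * l"
      by (metis evenE odd_add odd_one)
    then have "m * (m * (m + 1) div 2) = m\<^sup>2 * l"
      by (simp add: power2_eq_square mult_ac)
    then show ?thesis
      using True by (simp add: mu2_def)
  next
    case False
    then obtain l where "m = 2 * l"
      by (auto elim!: evenE)
    then have "m * (m * (m + 1) div 2) = m * l * (m + 1)" "mu2 m = m * l"
      by (simp_all add: mu2_def power2_eq_square mult_ac)
    then show ?thesis
      by simp
  qed
  \<comment> \<open>Inside a block the coefficients i + 1 add up to a triangular number. Full blocks
    take \<open>t = m\<close>, the remainder takes \<open>t = r\<close>.\<close>
  have partial: "[(\<Sum>i<t. ?B (m * q + i)) = t * (t + 1) div 2 * ?B q] (mod m)"
    if "t \<le> m" for t q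
  proof -
    have "[(\<Sum>i<t. ?B (m * q + i)) = (\<Sum>i<t. (i + 1) * ?B q)] (mod m)"
      using assms(1) that by (intro cong_sum mary_partition_count_mult_add_cong) auto
    then show ?thesis
      by (simp only: sum_distrib_right[symmetric] sum_Suc_lessThan)
  qed
  have "[m * (\<Sum>i<m. ?B (m * q + i)) = 0] (mod mu2 m)" for q
  proof -
    have "[m * (\<Sum>i<m. ?B (m * q + i)) = m * (m * (m + 1) div 2 * ?B q)] (mod mu2 m)"
      by (intro cong_mult_mu2 partial order.refl)
    also have "[m * (m * (m + 1) div 2 * ?B q) = 0] (mod mu2 m)"
      unfolding cong_0_iff mult.assoc[symmetric] by (intro dvd_mult2 triangle)
    finally show ?thesis .
  qed
  then have "[(\<Sum>q<p. m * (\<Sum>i<m. ?B (m * q + i))) = (\<Sum>q<p. 0)] (mod mu2 m)"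
    by (intro cong_sum)
  moreover have "[m * (\<Sum>i<r. ?B (m * p + i)) =
      m * (r * (r + 1) div 2 * ?B p)] (mod mu2 m)"
    using assms by (intro cong_mult_mu2 partial) simp
  ultimately have "[(\<Sum>q<p. m * (\<Sum>i<m. ?B (m * q + i))) + m * (\<Sum>i<r. ?B (m * p + i)) =
      (\<Sum>q<p. 0) + m * (r * (r + 1) div 2 * ?B p)] (mod mu2 m)"
    by (rule cong_add)
  then show ?thesis
    by (simp only: sum_lessThan_mult_add[of ?B] distrib_left sum_distrib_left
        sum.neutral_const add_0)
qed

text \<open>The summand i = 1 omits digits 0 and 1; each later one keeps digit 0, whose factor comes
  out and leaves the same kind of sum for the shifted digits. In the theorem \<open>f\<close> is the
  triangular number.\<close>

lemma sum_excluded_products_Suc: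
  fixes a :: "nat \<Rightarrow> nat"
  shows "(\<Sum>i=1..Suc s. f (a i) * (\<Prod>j\<in>{0..Suc s} - {i, i - 1}. a j + 1)) =
    f (a 1) * (\<Prod>j<s. a (Suc (Suc j)) + 1) +
    (a 0 + 1) * (\<Sum>i=1..s. f (a (Suc i)) * (\<Prod>j\<in>{0..s} - {i, i - 1}. a (Suc j) + 1))"
proof -
  have set1: "{0..Suc s} - {1, 0} = (\<lambda>j. Suc (Suc j)) ` {..<s}"
  proof (intro set_eqI iffI)
    fix x assume "x \<in> {0..Suc s} - {1, 0}"
    then show "x \<in> (\<lambda>j. Suc (Suc j)) ` {..<s}"
      by (intro image_eqI[of _ _ "x - 2"]) auto
  qed auto
  \<comment> \<open>As i is at least 1, both omitted indices are positive: 0 survives, and they are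
    the successors of i and i - 1.\<close>
  have "{0..Suc s} - {Suc i, i} = insert 0 (Suc ` ({0..s} - {i, i - 1}))"
    if "i \<in> {1..s}" for i
  proof (intro set_eqI iffI)
    fix x assume "x \<in> {0..Suc s} - {Suc i, i}"
    then show "x \<in> insert 0 (Suc ` ({0..s} - {i, i - 1}))"
      by (cases x) auto
  qed (use that in auto)
  then have "(\<Prod>j\<in>{0..Suc s} - {Suc i, i}. a j + 1) =
      (a 0 + 1) * (\<Prod>j\<in>{0..s} - {i, i - 1}. a (Suc j) + 1)" if "i \<in> {1..s}" for i
    using that by (simp add: prod.reindex)
  then have "(\<Sum>i=1..s. f (a (Suc i)) * (\<Prod>j\<in>{0..Suc s} - {Suc i, i}. a j + 1)) =
      (a 0 + 1) * (\<Sum>i=1..s. f (a (Suc i)) * (\<Prod>j\<in>{0..s} - {i, i - 1}. a (Suc j) + 1))"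
    unfolding sum_distrib_left by (intro sum.cong) (simp_all add: algebra_simps)
  moreover have "(\<Prod>j\<in>{0..Suc s} - {1, 0}. a j + 1) = (\<Prod>j<s. a (Suc (Suc j)) + 1)"
    unfolding set1 by (simp add: prod.reindex inj_on_def)
  moreover have shift: "(\<Sum>i=1..Suc s. g i) = g 1 + (\<Sum>i=1..s. g (Suc i))" for g :: "nat \<Rightarrow> nat"
    using sum.atLeast_Suc_atMost[of 1 "Suc s" g] sum.shift_bounds_cl_Suc_ivl[of g 1 s] by simp
  ultimately show ?thesis
    by (simp only: shift diff_Suc_1 diff_self_eq_0)
qed

theorem theorem12:
  fixes m n s :: nat and a :: "nat \<Rightarrow> nat"
  assumes "m > 1"
    and "n = (\<Sum>j=0..s. a j * m ^ j)"
    and "\<And>j. j \<le> s \<Longrightarrow> a j \<le> m - 1"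
  shows "[mary_partition_count m (m * n) =
           (\<Prod>i=0..s. (a i + 1)) +
           m * (\<Sum>i=1..s. (a i * (a i + 1)) div 2 *
                  (\<Prod>j\<in>{0..s} - {i, i - 1}. (a j + 1)))] (mod mu2 m)"
  using assms(2,3)
proof (induction s arbitrary: a n)
  case 0
  \<comment> \<open>For a single digit the exact recurrence is taken at q = 0, where its sum is
    empty and b(0) = 1.\<close>
  then have "mary_partition_count m (m * n) = a 0 + 1"
    using mary_partition_count_mult_add[of m "a 0" 0] assms(1)
    by (simp add: mary_partition_count_0)
  then show ?case
    by simp
next
  case (Suc s)
  let ?B = "\<lambda>k. mary_partition_count m (m * k)"
  let ?t = "\<lambda>x :: nat. x * (x + 1) div 2"
  \<comment> \<open>Two digits are peeled off: B(n) involves S(q), and S(q) in turn depends on the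
    lowest digit \<open>a 1\<close> of q and on B(p).\<close>
  define p where "p = (\<Sum>j<s. a (Suc (Suc j)) * m ^ j)"
  define q where "q = (\<Sum>j=0..s. a (Suc j) * m ^ j)"
  define P where "P = (\<Prod>j<s. a (Suc (Suc j)) + 1)"
  define R where "R = (\<Sum>i=1..s. ?t (a (Suc i)) * (\<Prod>j\<in>{0..s} - {i, i - 1}. a (Suc j) + 1))"
  have digit: "a j < m" if "j \<le> Suc s" for j
    using Suc.prems(2)[OF that] assms(1) by simp
  have n: "n = m * q + a 0"
    unfolding Suc.prems(1) q_def
    by (subst sum.atLeast0_atMost_Suc_shift) (simp add: sum_distrib_left mult_ac)
  have q: "q = m * p + a 1"
    unfolding q_def p_def atLeast0AtMost lessThan_Suc_atMost[symmetric]
    by (subst sum.lessThan_Suc_shift) (simp add: sum_distrib_left mult_ac)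
  \<comment> \<open>B(p) enters only behind a factor m, so its product formula modulo m suffices;
    the induction hypothesis is reserved for q.\<close>
  have "[?B p = P] (mod m)"
    unfolding p_def P_def using assms(1) digit by (intro mary_partition_count_digits_cong) auto
  then have "[m * ?B p = m * P] (mod mu2 m)"
    by (rule cong_mult_mu2)
  then have "[?t (a 1) * (m * ?B p) = ?t (a 1) * (m * P)] (mod mu2 m)"
    by (rule cong_scalar_left)
  then have "[m * (?t (a 1) * ?B p) = m * (?t (a 1) * P)] (mod mu2 m)"
    by (simp only: mult.left_commute)
  moreover have "[m * (\<Sum>k<q. ?B k) = m * (?t (a 1) * ?B p)] (mod mu2 m)"
    unfolding q using assms(1) digit by (intro sum_mary_partition_count_cong) auto
  ultimately have S: "[m * (\<Sum>k<q. ?B k) = m * (?t (a 1) * P)] (mod mu2 m)"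
    by (blast intro: cong_trans)
  have "[?B q = (\<Prod>i=0..s. a (Suc i) + 1) + m * R] (mod mu2 m)"
    unfolding R_def using Suc.prems(2) by (intro Suc.IH) (auto simp: q_def)
  then have "[(a 0 + 1) * ?B q + m * (\<Sum>k<q. ?B k) =
      (a 0 + 1) * ((\<Prod>i=0..s. a (Suc i) + 1) + m * R) + m * (?t (a 1) * P)] (mod mu2 m)"
    by (intro cong_add cong_scalar_left S)
  moreover have "?B n = (a 0 + 1) * ?B q + m * (\<Sum>k<q. ?B k)"
    unfolding n using assms(1) digit by (intro mary_partition_count_mult_add) auto
  moreover have "(\<Prod>i=0..Suc s. a i + 1) = (a 0 + 1) * (\<Prod>i=0..s. a (Suc i) + 1)"
    by (subst prod.atLeast0_atMost_Suc_shift) simp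
  \<comment> \<open>The i = 1 summand is what S(q) supplies; the others come from B(q), multiplied
    by \<open>a 0 + 1\<close>.\<close>
  moreover have "(\<Sum>i=1..Suc s. ?t (a i) * (\<Prod>j\<in>{0..Suc s} - {i, i - 1}. a j + 1)) =
      ?t (a 1) * P + (a 0 + 1) * R"
    unfolding P_def R_def by (rule sum_excluded_products_Suc)
  moreover have "(a 0 + 1) * (X + m * R) + m * Y = (a 0 + 1) * X + m * (Y + (a 0 + 1) * R)"
    for X Y
    by (simp add: algebra_simps)
  ultimately show ?case
    by (simp only:)
qed

end
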